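(* Suppose $f\colon X\to Y$ is a map. (a) If $f\colon X\to Y$ is a Peano covering map, then $f\colon f^{-1}(U)\to U$ is a Peano covering map for every open subset $U$ of $Y$. (b) If every point $y\in Y$ has a neighborhood $U$ such that $f\colon f^{-1}(U)\to U$ is a Peano covering map, then $f$ is a Peano covering map.
   Context: Maps are continuous. A map $f\colon X\to Y$ is a Peano map if the family of path components of $f^{-1}(U)$, $U$ open in $Y$, forms a basis of (open) neighborhoods of $X$. A map is a Serre fibration if it has the homotopy lifting property with respect to all cubes $I^n$, $n\ge 0$. A map $f\colon X\to Y$ is a Peano covering map if it is a Peano map, it is a Serre fibration, and the fibers of $f$ have trivial (one-point) path components. *)

theory Defs
  imports "HOL-Analysis.Analysis"
begin

abbreviation map_preimage :: "'a topology \<Rightarrow> ('a \<Rightarrow> 'b) \<Rightarrow> 'b set \<Rightarrow> 'a set" where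
  "map_preimage X f U \<equiv> {x \<in> topspace X. f x \<in> U}"

definition cube :: "nat \<Rightarrow> (nat \<Rightarrow> real) topology" where
  "cube n = product_topology (\<lambda>i. top_of_set {0..1}) {..<n}"

(* openin X = arbitrary union_of P says that the sets satisfying P are open and form
   a base of the topology of X (see openin_topology_base_unique). For the family below
   it makes no difference whether neighbourhoods are required to be open: a path component
   that is a neighbourhood of each of its points is open. *)
definition peano_map :: "'a topology \<Rightarrow> 'b topology \<Rightarrow> ('a \<Rightarrow> 'b) \<Rightarrow> bool" where
  "peano_map X Y f \<longleftrightarrow>
     continuous_map X Y f \<and>
     openin X = arbitrary union_of
       (\<lambda>C. \<exists>U. openin Y U \<and> C \<in> path_components_of (subtopology X (map_preimage X f U)))"

(* The time coordinate comes first, as in homotopic_with. *)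
definition homotopy_lifting_property ::
    "'z topology \<Rightarrow> 'a topology \<Rightarrow> 'b topology \<Rightarrow> ('a \<Rightarrow> 'b) \<Rightarrow> bool" where
  "homotopy_lifting_property Z X Y f \<longleftrightarrow>
     (\<forall>h g. continuous_map (prod_topology (top_of_set {0..1::real}) Z) Y h \<and>
            continuous_map Z X g \<and> (\<forall>z \<in> topspace Z. f (g z) = h (0, z)) \<longrightarrow>
        (\<exists>k. continuous_map (prod_topology (top_of_set {0..1::real}) Z) X k \<and>
             (\<forall>z \<in> topspace Z. k (0, z) = g z) \<and>
             (\<forall>t \<in> {0..1}. \<forall>z \<in> topspace Z. f (k (t, z)) = h (t, z))))"

definition serre_fibration :: "'a topology \<Rightarrow> 'b topology \<Rightarrow> ('a \<Rightarrow> 'b) \<Rightarrow> bool" where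
  "serre_fibration X Y f \<longleftrightarrow>
     continuous_map X Y f \<and> (\<forall>n. homotopy_lifting_property (cube n) X Y f)"

(* Fibres are allowed to be empty: surjectivity is not part of the definition. *)
definition peano_covering_map :: "'a topology \<Rightarrow> 'b topology \<Rightarrow> ('a \<Rightarrow> 'b) \<Rightarrow> bool" where
  "peano_covering_map X Y f \<longleftrightarrow>
     peano_map X Y f \<and> serre_fibration X Y f \<and>
     (\<forall>y \<in> topspace Y. \<forall>C \<in> path_components_of (subtopology X (map_preimage X f {y})).
        \<exists>x. C = {x})"

(* Neighbourhoods need not be open. *)
definition neighbourhood_in :: "'a topology \<Rightarrow> 'a \<Rightarrow> 'a set \<Rightarrow> bool" where
  "neighbourhood_in X x N \<longleftrightarrow> N \<subseteq> topspace X \<and> (\<exists>V. openin X V \<and> x \<in> V \<and> V \<subseteq> N)"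

end

theory Submission
  imports Defs
begin

text \<open>All three ingredients of a Peano covering map restrict to \<open>f\<^sup>-\<^sup>1(U) \<rightarrow> U\<close> for open \<open>U\<close>: path components of
\<open>f\<^sup>-\<^sup>1(W)\<close> with \<open>W \<subseteq> U\<close> do not depend on whether they are formed in \<open>X\<close> or in \<open>f\<^sup>-\<^sup>1(U)\<close>, nor do
the fibres, and a lift of a homotopy in \<open>U\<close> automatically stays in \<open>f\<^sup>-\<^sup>1(U)\<close>. That is part (a)
(\<open>peano_covering_map_restrict_open\<close>). It also shrinks the neighbourhoods in (b) to open
sets, so that \<open>Y\<close> is covered by open sets \<open>V\<close> over which \<open>f\<close> is a Peano covering map.

Under this hypothesis the Peano property and the condition on fibres are visibly local on \<open>Y\<close>; the
work is in the lifting of homotopies. Local lifts exist, and they can be glued because path lifts are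
unique.

Uniqueness: let \<open>p\<close>, \<open>q\<close> be paths with the same image under a Peano covering map and the same
initial point. The path that runs backwards along \<open>p\<close> and then forwards along \<open>q\<close> projects to
a path that traverses \<open>f \<circ> p\<close> back and forth. Contract that projected path, relative to its endpoints,
and lift the contraction: the three remaining edges of the square map into a single fibre, on which
paths are constant, so \<open>p\<close> and \<open>q\<close> have the same endpoint (\<open>path_lifts_agree_at_end\<close>). Subdividing
the parameter interval yields uniqueness of path lifts when \<open>f\<close> is only locally a Peano
covering map (\<open>unique_path_lifting_local\<close>).

Existence: let \<open>h\<close> be a homotopy on \<open>[0,1] \<times> Z\<close>. Around each point of \<open>Z\<close> there is
a neighbourhood \<open>N\<close> such that, for a subdivision of \<open>[0,1]\<close>, each piece of \<open>[0,1] \<times> N\<close> is mapped into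
some \<open>V\<close>. If \<open>N\<close> contains a retract \<open>A\<close> of \<open>Z\<close>, the lifting property for \<open>Z\<close>
passes to \<open>A\<close>, and the homotopy can be lifted on \<open>[0,1] \<times> A\<close> one piece after the other. In a cube
such retracts form a base of neighbourhoods: clamping the coordinates retracts the cube onto a
subbox. By uniqueness of path lifts, applied to the vertical lines \<open>[0,1] \<times> {z}\<close>, these local lifts
agree where they overlap, and they glue to a continuous lift
(\<open>homotopy_lifting_property_local\<close>).\<close>

section \<open>Restriction to an open subset of the base\<close>

lemma continuous_map_compose_paired:
  assumes "continuous_map (prod_topology S Z) Y h" "continuous_map W S a" "continuous_map W Z b"
  shows "continuous_map W Y (\<lambda>w. h (a w, b w))"
proof -
  have "continuous_map W (prod_topology S Z) (\<lambda>w. (a w, b w))"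
    using assms(2,3) by (simp add: continuous_map_paired)
  from continuous_map_compose[OF this assms(1)] show ?thesis by (simp add: o_def)
qed

lemma map_preimage_subtopology:
  assumes "W \<subseteq> U"
  shows "subtopology (subtopology X (map_preimage X f U))
           (map_preimage (subtopology X (map_preimage X f U)) f W) = subtopology X (map_preimage X f W)"
proof -
  have "map_preimage X f U \<inter> map_preimage (subtopology X (map_preimage X f U)) f W = map_preimage X f W"
    using assms by auto
  then show ?thesis by (simp add: subtopology_subtopology)
qed

lemma continuous_map_restrict_over:
  assumes "continuous_map X Y f"
  shows "continuous_map (subtopology X (map_preimage X f U)) (subtopology Y U) f"
  using assms by (auto simp: continuous_map_in_subtopology continuous_map_from_subtopology)

text \<open>A base of path components can be tested pointwise: every component has to be open, and the component
of \<open>x\<close> has to fit into any given neighbourhood of \<open>x\<close>. A basic set that contains \<open>x\<close>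
contains the component of \<open>x\<close>, so nothing is lost by considering only the latter.\<close>

lemma peano_map_iff:
  "peano_map X Y f \<longleftrightarrow> continuous_map X Y f \<and>
     (\<forall>U x. openin Y U \<and> x \<in> map_preimage X f U \<longrightarrow>
        openin X (path_component_of_set (subtopology X (map_preimage X f U)) x)) \<and>
     (\<forall>G x. openin X G \<and> x \<in> G \<longrightarrow> (\<exists>U. openin Y U \<and> f x \<in> U \<and>
        path_component_of_set (subtopology X (map_preimage X f U)) x \<subseteq> G))"
    (is "?L \<longleftrightarrow> _ \<and> ?A \<and> ?B")
proof (intro iffI conjI)
  assume L: ?L
  then show "continuous_map X Y f" by (simp add: peano_map_def)
  have op: "\<And>U C. openin Y U \<Longrightarrow> C \<in> path_components_of (subtopology X (map_preimage X f U)) \<Longrightarrow> openin X C"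
    and base: "\<And>G x. openin X G \<Longrightarrow> x \<in> G \<Longrightarrow>
      \<exists>C. (\<exists>U. openin Y U \<and> C \<in> path_components_of (subtopology X (map_preimage X f U))) \<and> x \<in> C \<and> C \<subseteq> G"
    using L by (auto simp: peano_map_def openin_topology_base_unique)
  show ?A
    by (auto intro!: op simp: path_component_in_path_components_of)
  show ?B
  proof (intro allI impI, elim conjE)
    fix G x assume "openin X G" "x \<in> G"
    then obtain C U where U: "openin Y U" "C \<in> path_components_of (subtopology X (map_preimage X f U))"
      "x \<in> C" "C \<subseteq> G" using base by blast
    then have "x \<in> map_preimage X f U"
      using path_components_of_subset by fastforce
    moreover have "path_component_of_set (subtopology X (map_preimage X f U)) x \<subseteq> C"
      using U(2,3) by (auto simp: path_components_of_def intro: path_component_of_trans)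
    ultimately show "\<exists>U. openin Y U \<and> f x \<in> U \<and>
        path_component_of_set (subtopology X (map_preimage X f U)) x \<subseteq> G"
      using U by blast
  qed
next
  assume R: "continuous_map X Y f \<and> ?A \<and> ?B"
  show ?L
    unfolding peano_map_def openin_topology_base_unique
  proof (intro conjI allI impI, goal_cases)
    case 1 then show ?case using R by blast
  next
    case (2 C) then show ?case using R by (fastforce simp: path_components_of_def)
  next
    case (3 G x)
    then have xX: "x \<in> topspace X" using openin_subset by blast
    obtain U where U: "openin Y U" "f x \<in> U"
        "path_component_of_set (subtopology X (map_preimage X f U)) x \<subseteq> G"
      using R 3 by blast
    with xX show ?case
      by (intro exI[of _ "path_component_of_set (subtopology X (map_preimage X f U)) x"])
         (auto simp: path_component_in_path_components_of path_component_of_refl)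
  qed
qed

lemma peano_map_openin_component:
  assumes "peano_map X Y f" "openin Y U" "x \<in> topspace X" "f x \<in> U"
  shows "openin X (path_component_of_set (subtopology X (map_preimage X f U)) x)"
  using assms by (simp add: peano_map_iff)

lemma peano_map_small_component:
  assumes "peano_map X Y f" "openin X G" "x \<in> G"
  obtains U where "openin Y U" "f x \<in> U"
    "path_component_of_set (subtopology X (map_preimage X f U)) x \<subseteq> G"
  using assms unfolding peano_map_iff by blast

text \<open>For the base at \<open>x\<close>, intersect with \<open>U\<close> the open set that the Peano property of \<open>f\<close> provides: a smaller
preimage has a smaller path component at \<open>x\<close>.\<close>

lemma peano_map_restrict_open:
  assumes P: "peano_map X Y f" and U: "openin Y U"
  shows "peano_map (subtopology X (map_preimage X f U)) (subtopology Y U) f"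
  unfolding peano_map_iff
proof (intro conjI allI impI; (elim conjE)?)
  have cont: "continuous_map X Y f" using P by (simp add: peano_map_iff)
  then show "continuous_map (subtopology X (map_preimage X f U)) (subtopology Y U) f"
    by (rule continuous_map_restrict_over)
  have pre: "openin X (map_preimage X f U)" using cont U by (rule openin_continuous_map_preimage)
  let ?E = "subtopology X (map_preimage X f U)"
  fix W x assume "openin (subtopology Y U) W" and x: "x \<in> map_preimage ?E f W"
  then have W: "openin Y W" "W \<subseteq> U" using U by (auto simp: openin_open_subtopology)
  have "path_component_of_set (subtopology X (map_preimage X f W)) x \<subseteq> map_preimage X f W"
    using path_component_of_subset_topspace[of "subtopology X (map_preimage X f W)" x] by auto
  then show "openin ?E (path_component_of_set (subtopology ?E (map_preimage ?E f W)) x)"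
    using peano_map_openin_component[OF P W(1), of x] W(2) x pre
    unfolding map_preimage_subtopology[OF W(2)] by (auto simp: openin_open_subtopology)
next
  let ?E = "subtopology X (map_preimage X f U)"
  have pre: "openin X (map_preimage X f U)"
    using P U by (auto simp: peano_map_iff intro: openin_continuous_map_preimage)
  fix G x assume "openin ?E G" and x: "x \<in> G"
  then have G: "openin X G" "G \<subseteq> map_preimage X f U" using pre by (simp_all add: openin_open_subtopology)
  then obtain W where W: "openin Y W" "f x \<in> W"
      "path_component_of_set (subtopology X (map_preimage X f W)) x \<subseteq> G"
    using peano_map_small_component[OF P G(1) x] by blast
  have "map_preimage X f (W \<inter> U) \<subseteq> map_preimage X f W" by auto
  then have "path_component_of_set (subtopology X (map_preimage X f (W \<inter> U))) x \<subseteq> G"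
    using W(3) path_component_of_mono by fastforce
  moreover have "openin (subtopology Y U) (W \<inter> U)" using W U by (simp add: openin_open_subtopology openin_Int)
  moreover have "f x \<in> W \<inter> U" using W x G(2) by auto
  ultimately show "\<exists>V. openin (subtopology Y U) V \<and> f x \<in> V \<and>
        path_component_of_set (subtopology ?E (map_preimage ?E f V)) x \<subseteq> G"
    using map_preimage_subtopology[of "W \<inter> U" U X f] by (intro exI[of _ "W \<inter> U"]) simp
qed

lemma homotopy_lifting_property_restrict_over:
  assumes H: "homotopy_lifting_property Z X Y f"
  shows "homotopy_lifting_property Z (subtopology X (map_preimage X f U)) (subtopology Y U) f"
  unfolding homotopy_lifting_property_def
proof (intro allI impI, elim conjE)
  fix h g
  assume h: "continuous_map (prod_topology (top_of_set {0..1::real}) Z) (subtopology Y U) h"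
    and g: "continuous_map Z (subtopology X (map_preimage X f U)) g"
    and hg: "\<forall>z\<in>topspace Z. f (g z) = h (0, z)"
  obtain k where k: "continuous_map (prod_topology (top_of_set {0..1::real}) Z) X k"
      "\<forall>z\<in>topspace Z. k (0, z) = g z" "\<forall>t\<in>{0..1}. \<forall>z\<in>topspace Z. f (k (t, z)) = h (t, z)"
    using H[unfolded homotopy_lifting_property_def, rule_format, of h g] h g hg
    by (auto simp: continuous_map_in_subtopology)
  have "k p \<in> map_preimage X f U" if "p \<in> topspace (prod_topology (top_of_set {0..1::real}) Z)" for p
    using that k h continuous_map_image_subset_topspace[OF k(1)]
    by (cases p) (auto simp: continuous_map_in_subtopology Pi_iff)
  then have "continuous_map (prod_topology (top_of_set {0..1::real}) Z) (subtopology X (map_preimage X f U)) k"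
    using k(1) by (auto simp: continuous_map_in_subtopology)
  then show "\<exists>k. continuous_map (prod_topology (top_of_set {0..1}) Z) (subtopology X (map_preimage X f U)) k \<and>
      (\<forall>z\<in>topspace Z. k (0, z) = g z) \<and> (\<forall>t\<in>{0..1}. \<forall>z\<in>topspace Z. f (k (t, z)) = h (t, z))"
    using k by blast
qed

lemma peano_covering_map_restrict_open:
  assumes P: "peano_covering_map X Y f" and U: "openin Y U"
  shows "peano_covering_map (subtopology X (map_preimage X f U)) (subtopology Y U) f"
  unfolding peano_covering_map_def
proof (intro conjI)
  show "peano_map (subtopology X (map_preimage X f U)) (subtopology Y U) f"
    using assms by (simp add: peano_covering_map_def peano_map_restrict_open)
  show "serre_fibration (subtopology X (map_preimage X f U)) (subtopology Y U) f"
    using P by (simp add: peano_covering_map_def serre_fibration_def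
        continuous_map_restrict_over homotopy_lifting_property_restrict_over)
  show "\<forall>y\<in>topspace (subtopology Y U).
      \<forall>C\<in>path_components_of (subtopology (subtopology X (map_preimage X f U))
                    (map_preimage (subtopology X (map_preimage X f U)) f {y})). \<exists>x. C = {x}"
  proof (intro ballI)
    let ?E = "subtopology X (map_preimage X f U)"
    fix y C assume y: "y \<in> topspace (subtopology Y U)"
      and C: "C \<in> path_components_of (subtopology ?E (map_preimage ?E f {y}))"
    then have "C \<in> path_components_of (subtopology X (map_preimage X f {y}))"
      using map_preimage_subtopology[of "{y}" U X f] by simp
    with P y show "\<exists>x. C = {x}" unfolding peano_covering_map_def by auto
  qed
qed

section \<open>Uniqueness of path lifts\<close>

text \<open>Precompose with the retraction, lift over \<open>Z\<close>, and restrict along the section.\<close>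

lemma homotopy_lifting_property_retract:
  assumes H: "homotopy_lifting_property Z X Y f" and r: "retraction_maps Z A r i"
  shows "homotopy_lifting_property A X Y f"
  unfolding homotopy_lifting_property_def
proof (intro allI impI, elim conjE)
  let ?I = "top_of_set {0..1::real}"
  fix h g
  assume h: "continuous_map (prod_topology ?I A) Y h"
    and g: "continuous_map A X g"
    and hg: "\<forall>z\<in>topspace A. f (g z) = h (0, z)"
  have r': "continuous_map Z A r" "continuous_map A Z i" "\<And>a. a \<in> topspace A \<Longrightarrow> r (i a) = a"
    using r by (auto simp: retraction_maps_def)
  have "continuous_map (prod_topology ?I Z) Y (\<lambda>w. h (fst w, r (snd w)))"
    by (rule continuous_map_compose_paired[OF h continuous_map_fst])
       (use continuous_map_compose[OF continuous_map_snd r'(1)] in \<open>simp add: o_def\<close>)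
  moreover have "continuous_map Z X (\<lambda>z. g (r z))"
    using continuous_map_compose[OF r'(1) g] by (simp add: o_def)
  moreover have "r z \<in> topspace A" if "z \<in> topspace Z" for z
    using that r'(1) continuous_map_image_subset_topspace by blast
  ultimately obtain k where k: "continuous_map (prod_topology ?I Z) X k"
      "\<forall>z\<in>topspace Z. k (0, z) = g (r z)"
      "\<forall>t\<in>{0..1}. \<forall>z\<in>topspace Z. f (k (t, z)) = h (t, r z)"
    using H[unfolded homotopy_lifting_property_def, rule_format, of "\<lambda>w. h (fst w, r (snd w))" "\<lambda>z. g (r z)"]
      hg by auto
  have "continuous_map (prod_topology ?I A) X (\<lambda>w. k (fst w, i (snd w)))"
    by (rule continuous_map_compose_paired[OF k(1) continuous_map_fst])
       (use continuous_map_compose[OF continuous_map_snd r'(2)] in \<open>simp add: o_def\<close>)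
  moreover have "i a \<in> topspace Z" if "a \<in> topspace A" for a
    using that r'(2) continuous_map_image_subset_topspace by blast
  ultimately show "\<exists>k. continuous_map (prod_topology ?I A) X k \<and> (\<forall>z\<in>topspace A. k (0, z) = g z) \<and>
           (\<forall>t\<in>{0..1}. \<forall>z\<in>topspace A. f (k (t, z)) = h (t, z))"
    using k r'(3) by (intro exI[of _ "\<lambda>w. k (fst w, i (snd w))"]) auto
qed

text \<open>Together with \<open>homotopy_lifting_property_retract\<close> this makes squares \<open>[0,1] \<times> [0,1]\<close> available, without the
encoding of points of the interval as functions.\<close>

lemma retraction_maps_cube_interval:
  "retraction_maps (cube 1) (top_of_set {0..1}) (\<lambda>z. z 0) (\<lambda>t. \<lambda>i\<in>{..<1::nat}. t)"
  unfolding retraction_maps_def cube_def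
  using continuous_map_product_projection[of 0 "{..<1::nat}" "\<lambda>i. top_of_set {0..1::real}"]
  by (auto simp: continuous_map_componentwise)

lemma pathin_in_fibre_closed:
  assumes "continuous_map X Y f"
    and triv: "\<forall>y \<in> topspace Y. \<forall>C \<in> path_components_of (subtopology X (map_preimage X f {y})). \<exists>x. C = {x}"
    and p: "pathin X p" and fib: "\<And>t. t \<in> {0..1} \<Longrightarrow> f (p t) = y"
  shows "p 0 = p 1"
proof -
  have X: "p t \<in> topspace X" if "t \<in> {0..1}" for t
    using p that continuous_map_image_subset_topspace unfolding pathin_def by fastforce
  then have p0: "p 0 \<in> topspace X" by simp
  then have y: "y \<in> topspace Y" using fib[of 0] assms(1) continuous_map_image_subset_topspace by fastforce
  let ?F = "subtopology X (map_preimage X f {y})"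
  have "pathin ?F p" using p X fib by (auto simp: pathin_subtopology)
  then have p1: "p 1 \<in> path_component_of_set ?F (p 0)" by (auto simp: path_component_of_def)
  have F0: "p 0 \<in> topspace ?F" using p0 fib[of 0] by simp
  then have "p 0 \<in> path_component_of_set ?F (p 0)" by (simp only: mem_Collect_eq path_component_of_refl)
  moreover have "path_component_of_set ?F (p 0) \<in> path_components_of ?F"
    using F0 by (simp only: path_component_in_path_components_of)
  then obtain x where "path_component_of_set ?F (p 0) = {x}"
    using triv y by blast
  ultimately show ?thesis using p1 by (simp only: singleton_iff)
qed

text \<open>With \<open>\<alpha> = f \<circ> p = f \<circ> q\<close>, the map \<open>g\<close> is the path from \<open>p 1\<close> to \<open>q 1\<close> through the common initial point,
and \<open>f \<circ> g\<close> is \<open>\<alpha>(\<bar>2s - 1\<bar>)\<close>. The homotopy \<open>h(t, s) = \<alpha>(max \<bar>2s - 1\<bar> t)\<close> skips the part of \<open>\<alpha>\<close> before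
time \<open>t\<close>. It has the value \<open>\<alpha>(1)\<close> on the edges \<open>s = 0\<close>, \<open>s = 1\<close> and \<open>t = 1\<close>, so that a lift is constant on
each of them; following these three edges leads from \<open>p 1\<close> to \<open>q 1\<close>.\<close>

lemma path_lifts_agree_at_end:
  assumes P: "peano_covering_map X Y f"
    and p: "pathin X p" and q: "pathin X q"
    and fpq: "\<And>t. t \<in> {0..1} \<Longrightarrow> f (p t) = f (q t)" and start: "p 0 = q 0"
  shows "p 1 = q 1"
proof -
  let ?I = "top_of_set {0..1::real}"
  have cont: "continuous_map X Y f"
    and triv: "\<forall>y \<in> topspace Y. \<forall>C \<in> path_components_of (subtopology X (map_preimage X f {y})). \<exists>x. C = {x}"
    using P by (auto simp: peano_covering_map_def peano_map_def)
  have HLP: "homotopy_lifting_property ?I X Y f"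
    using P homotopy_lifting_property_retract[OF _ retraction_maps_cube_interval]
    unfolding peano_covering_map_def serre_fibration_def by blast
  have cp: "continuous_map ?I X p" "continuous_map ?I X q" using p q by (auto simp: pathin_def)
  define g where "g s = (if s \<le> 1/2 then p (1 - 2 * s) else q (2 * s - 1))" for s :: real
  define h where "h = (\<lambda>w::real\<times>real. f (p (max \<bar>2 * snd w - 1\<bar> (fst w))))"
  have g: "continuous_map ?I X g"
    unfolding g_def
  proof (rule continuous_map_cases_le)
    show "continuous_map (subtopology ?I {s \<in> topspace ?I. s \<le> 1/2}) X (\<lambda>s. p (1 - 2 * s))"
      by (rule continuous_map_compose[OF _ cp(1), unfolded o_def])
         (auto simp: subtopology_subtopology intro!: continuous_intros)
    show "continuous_map (subtopology ?I {s \<in> topspace ?I. 1/2 \<le> s}) X (\<lambda>s. q (2 * s - 1))"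
      by (rule continuous_map_compose[OF _ cp(2), unfolded o_def])
         (auto simp: subtopology_subtopology intro!: continuous_intros)
    show "p (1 - 2 * s) = q (2 * s - 1)" if "s = 1/2" for s
      unfolding that using start by simp
  qed auto
  have "continuous_map (prod_topology ?I ?I) ?I (\<lambda>w. max \<bar>2 * snd w - 1\<bar> (fst w))"
    by (auto intro!: continuous_intros)
  from continuous_map_compose[OF this continuous_map_compose[OF cp(1) cont]]
  have h: "continuous_map (prod_topology ?I ?I) Y h"
    by (simp add: h_def o_def)
  have "f (g s) = h (0, s)" if "s \<in> {0..1}" for s
    using that fpq by (auto simp: g_def h_def abs_if max_def)
  then obtain k where k: "continuous_map (prod_topology ?I ?I) X k"
      "\<forall>s\<in>{0..1}. k (0, s) = g s" "\<forall>t\<in>{0..1}. \<forall>s\<in>{0..1}. f (k (t, s)) = h (t, s)"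
    using HLP[unfolded homotopy_lifting_property_def, rule_format, of h g] h g by auto
  have edge: "k (a 0, b 0) = k (a 1, b 1)"
    if a: "continuous_map ?I ?I a" and b: "continuous_map ?I ?I b"
      and hab: "\<And>t. t \<in> {0..1} \<Longrightarrow> h (a t, b t) = f (p 1)" for a b
  proof (rule pathin_in_fibre_closed[OF cont triv])
    show "pathin X (\<lambda>t. k (a t, b t))"
      unfolding pathin_def by (rule continuous_map_compose_paired[OF k(1) a b])
    show "f (k (a t, b t)) = f (p 1)" if "t \<in> {0..1}" for t
    proof -
      have "a t \<in> {0..1}" "b t \<in> {0..1}"
        using that continuous_map_image_subset_topspace[OF a] continuous_map_image_subset_topspace[OF b]
        by (auto simp: image_subset_iff)
      then show ?thesis using k(3) hab[OF that] by simp
    qed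
  qed
  have "p 1 = k (0, 0)" using k(2) by (simp add: g_def)
  also have "\<dots> = k (1, 0)" using edge[of "\<lambda>t. t" "\<lambda>_. 0"] by (auto simp: h_def)
  also have "\<dots> = k (1, 1)" using edge[of "\<lambda>_. 1" "\<lambda>t. t"] by (auto simp: h_def max_def abs_le_iff)
  also have "\<dots> = k (0, 1)" using edge[of "\<lambda>t. t" "\<lambda>_. 1"] by (auto simp: h_def max_absorb1)
  also have "\<dots> = q 1" using k(2) by (simp add: g_def)
  finally show ?thesis .
qed

lemma openin_unit_interval_ball:
  assumes "openin (top_of_set {0..1::real}) J" "x \<in> J"
  obtains d where "d > 0" "\<And>s. s \<in> {0..1} \<Longrightarrow> \<bar>s - x\<bar> < d \<Longrightarrow> s \<in> J"
  using assms unfolding openin_euclidean_subtopology_iff dist_real_def by blast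

definition unique_path_lifting :: "'a topology \<Rightarrow> ('a \<Rightarrow> 'b) \<Rightarrow> bool" where
  "unique_path_lifting X f \<longleftrightarrow>
     (\<forall>p q. pathin X p \<and> pathin X q \<and> (\<forall>t\<in>{0..1}. f (p t) = f (q t)) \<and> p 0 = q 0 \<longrightarrow>
        (\<forall>t\<in>{0..1}. p t = q t))"

text \<open>That agreement at time \<open>a\<close> implies agreement at time \<open>b\<close> is a transitive relation between \<open>a\<close> and
\<open>b\<close>. It holds for all short intervals, since there the projected path stays in one of the sets \<open>V\<close>;
Bolzano induction extends it to all of \<open>[0,t]\<close>.\<close>

lemma unique_path_lifting_local:
  assumes cont: "continuous_map X Y f"
    and loc: "\<And>y. y \<in> topspace Y \<Longrightarrow> \<exists>V. openin Y V \<and> y \<in> V \<and>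
        peano_covering_map (subtopology X (map_preimage X f V)) (subtopology Y V) f"
  shows "unique_path_lifting X f"
  unfolding unique_path_lifting_def
proof (intro allI impI ballI, elim conjE)
  fix p q :: "real \<Rightarrow> 'a" and t :: real
  assume p: "pathin X p" and q: "pathin X q" and fpq: "\<forall>t\<in>{0..1}. f (p t) = f (q t)"
    and start: "p 0 = q 0" and t: "t \<in> {0..1}"
  let ?I = "top_of_set {0..1::real}"
  have "0 \<le> t" using t by simp
  then have "0 \<le> (0::real) \<and> t \<le> 1 \<and> p 0 = q 0 \<longrightarrow> p t = q t"
  proof (induction rule: Bolzano[where P = "\<lambda>a b. 0 \<le> a \<and> b \<le> 1 \<and> p a = q a \<longrightarrow> p b = q b"])
    case (trans a b c) then show ?case by auto
  next
    case (local x)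
    then have x: "x \<in> {0..1}" using t by auto
    have fp: "continuous_map ?I Y (\<lambda>s. f (p s))"
      using continuous_map_compose[OF _ cont] p by (auto simp: pathin_def o_def)
    then have "f (p x) \<in> topspace Y"
      using x continuous_map_image_subset_topspace by fastforce
    then obtain V where V: "openin Y V" "f (p x) \<in> V"
        and PV: "peano_covering_map (subtopology X (map_preimage X f V)) (subtopology Y V) f"
      using loc by blast
    have "openin ?I {s \<in> topspace ?I. f (p s) \<in> V}" "x \<in> {s \<in> topspace ?I. f (p s) \<in> V}"
      using openin_continuous_map_preimage[OF fp V(1)] x V(2) by auto
    then obtain d where d: "d > 0"
        "\<And>s. s \<in> {0..1} \<Longrightarrow> \<bar>s - x\<bar> < d \<Longrightarrow> s \<in> {s \<in> topspace ?I. f (p s) \<in> V}"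
      using openin_unit_interval_ball by blast
    have step: "p b = q b" if ab: "a \<le> x" "x \<le> b" "b - a < d" "0 \<le> a" "b \<le> 1" "p a = q a" for a b
    proof -
      let ?s = "\<lambda>\<tau>. a + \<tau> * (b - a)"
      have s: "?s \<tau> \<in> {a..b}" if "\<tau> \<in> {0..1}" for \<tau>
        using that ab mult_left_le_one_le[of "b - a" \<tau>] by auto
      have s01: "?s \<tau> \<in> {0..1}" if "\<tau> \<in> {0..1}" for \<tau>
        using s[OF that] ab by auto
      have sV: "f (p (?s \<tau>)) \<in> V" if "\<tau> \<in> {0..1}" for \<tau>
      proof -
        have "\<bar>?s \<tau> - x\<bar> < d" using s[OF that] ab by auto
        then show ?thesis using d(2)[OF s01[OF that]] by simp
      qed
      have seg: "pathin (subtopology X (map_preimage X f V)) (\<lambda>\<tau>. r (?s \<tau>))"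
        if r: "pathin X r" "\<forall>t\<in>{0..1}. f (p t) = f (r t)" for r
      proof -
        have "continuous_map ?I ?I ?s"
          using s01 by (auto intro!: continuous_intros)
        then have "pathin X (\<lambda>\<tau>. r (?s \<tau>))"
          using continuous_map_compose r(1) unfolding pathin_def o_def by blast
        moreover have "r (?s \<tau>) \<in> topspace X" if "\<tau> \<in> {0..1}" for \<tau>
          using r(1) s01[OF that] continuous_map_image_subset_topspace unfolding pathin_def by fastforce
        ultimately show ?thesis using s01 sV r(2) by (auto simp: pathin_subtopology)
      qed
      have "p (?s 1) = q (?s 1)"
        by (rule path_lifts_agree_at_end[OF PV seg seg]) (use p q fpq s01 ab in auto)
      then show ?thesis by simp
    qed
    show ?case using d(1) by (intro exI[of _ d]) (auto intro: step)
  qed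
  with t start show "p t = q t" by simp
qed

section \<open>Lifting homotopies near a point of the parameter space\<close>

definition cylinder_lift ::
    "'a topology \<Rightarrow> 'z topology \<Rightarrow> ('a \<Rightarrow> 'b) \<Rightarrow> (real \<times> 'z \<Rightarrow> 'b) \<Rightarrow>
      real \<Rightarrow> real \<Rightarrow> 'z set \<Rightarrow> ('z \<Rightarrow> 'a) \<Rightarrow> (real \<times> 'z \<Rightarrow> 'a) \<Rightarrow> bool" where
  "cylinder_lift X Z f h a b A g k \<longleftrightarrow>
     continuous_map (prod_topology (top_of_set {a..b}) (subtopology Z A)) X k \<and>
     (\<forall>z\<in>A. k (a, z) = g z) \<and> (\<forall>t\<in>{a..b}. \<forall>z\<in>A. f (k (t, z)) = h (t, z))"

text \<open>The set \<open>A\<close> and the initial map \<open>g\<close> are quantified inside, because lifting over \<open>[a,c]\<close> continues a lift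
over \<open>[a,b]\<close> from its final map, which is known only on the same \<open>A\<close>. Quantifying over all
retracts inside \<open>N\<close> lets \<open>N\<close> shrink from one time interval to the next.\<close>

definition lifts_over_retracts ::
    "'a topology \<Rightarrow> 'z topology \<Rightarrow> ('a \<Rightarrow> 'b) \<Rightarrow> (real \<times> 'z \<Rightarrow> 'b) \<Rightarrow>
      real \<Rightarrow> real \<Rightarrow> 'z set \<Rightarrow> bool" where
  "lifts_over_retracts X Z f h a b N \<longleftrightarrow>
     (\<forall>A g. A retract_of_space Z \<and> A \<subseteq> N \<and> continuous_map (subtopology Z A) X g \<and>
            (\<forall>z\<in>A. f (g z) = h (a, z)) \<longrightarrow> (\<exists>k. cylinder_lift X Z f h a b A g k))"

lemma cylinder_lift_subset:
  assumes k: "cylinder_lift X Z f h a b A g k" and "W \<subseteq> A"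
  shows "cylinder_lift X Z f h a b W g k"
proof -
  let ?J = "top_of_set {a..b}"
  have "continuous_map (prod_topology ?J (subtopology Z W)) X (\<lambda>w. k (fst w, snd w))"
  proof (rule continuous_map_compose_paired[OF _ continuous_map_fst])
    show "continuous_map (prod_topology ?J (subtopology Z A)) X k"
      using k by (simp add: cylinder_lift_def)
    show "continuous_map (prod_topology ?J (subtopology Z W)) (subtopology Z A) snd"
      using continuous_map_snd[of ?J "subtopology Z W"] \<open>W \<subseteq> A\<close>
      by (auto simp: continuous_map_in_subtopology)
  qed
  then show ?thesis using k \<open>W \<subseteq> A\<close> by (auto simp: cylinder_lift_def)
qed

lemma cylinder_lift_glue:
  assumes k1: "cylinder_lift X Z f h a b A g k1"
    and k2: "cylinder_lift X Z f h b c A (\<lambda>z. k1 (b, z)) k2"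
    and abc: "a \<le> b" "b \<le> c"
  shows "cylinder_lift X Z f h a c A g (\<lambda>w. if fst w \<le> b then k1 w else k2 w)"
proof -
  let ?A = "subtopology Z A"
  let ?P = "prod_topology (top_of_set {a..c}) ?A"
  have "continuous_map ?P X (\<lambda>w. if fst w \<le> b then k1 w else k2 w)"
  proof (rule continuous_map_cases_le)
    show "continuous_map ?P euclideanreal fst"
      using continuous_map_fst[of "top_of_set {a..c}" ?A] by (simp add: continuous_map_in_subtopology)
    show "continuous_map ?P euclideanreal (\<lambda>_. b)" by simp
    have sub: "subtopology ?P {w \<in> topspace ?P. fst w \<in> {s..t}} = prod_topology (top_of_set {s..t}) ?A"
      if "{s..t} \<subseteq> {a..c}" for s t
    proof -
      have "{w \<in> topspace ?P. fst w \<in> {s..t}} = {s..t} \<times> topspace ?A"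
        using that by auto
      then have "subtopology ?P {w \<in> topspace ?P. fst w \<in> {s..t}}
          = prod_topology (subtopology (top_of_set {a..c}) {s..t}) (subtopology ?A (topspace ?A))"
        by (simp only: subtopology_Times)
      also have "\<dots> = prod_topology (top_of_set {s..t}) ?A"
        using that by (simp only: subtopology_subtopology Int_absorb1 subtopology_topspace)
      finally show ?thesis .
    qed
    have "{w \<in> topspace ?P. fst w \<le> b} = {w \<in> topspace ?P. fst w \<in> {a..b}}" by auto
    then show "continuous_map (subtopology ?P {w \<in> topspace ?P. fst w \<le> b}) X k1"
      using k1 abc sub[of a b] by (simp add: cylinder_lift_def)
    have "{w \<in> topspace ?P. b \<le> fst w} = {w \<in> topspace ?P. fst w \<in> {b..c}}" by auto
    then show "continuous_map (subtopology ?P {w \<in> topspace ?P. b \<le> fst w}) X k2"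
      using k2 abc sub[of b c] by (simp add: cylinder_lift_def)
    show "k1 w = k2 w" if "w \<in> topspace ?P" "fst w = b" for w
      using that k2 by (cases w) (auto simp: cylinder_lift_def)
  qed
  then show ?thesis using k1 k2 abc by (auto simp: cylinder_lift_def)
qed

lemma lifts_over_retracts_trans:
  assumes N1: "lifts_over_retracts X Z f h a b N1" and N2: "lifts_over_retracts X Z f h b c N2"
    and abc: "a \<le> b" "b \<le> c"
  shows "lifts_over_retracts X Z f h a c (N1 \<inter> N2)"
  unfolding lifts_over_retracts_def
proof (intro allI impI; elim conjE)
  fix A g
  assume A: "A retract_of_space Z" "A \<subseteq> N1 \<inter> N2"
    and g: "continuous_map (subtopology Z A) X g" "\<forall>z\<in>A. f (g z) = h (a, z)"
  obtain k1 where k1: "cylinder_lift X Z f h a b A g k1"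
    using N1 A g unfolding lifts_over_retracts_def by blast
  then have "continuous_map (subtopology Z A) X (\<lambda>z. k1 (b, z))"
    using abc
    by (intro continuous_map_compose_paired[of "top_of_set {a..b}" "subtopology Z A" X k1])
       (auto simp: cylinder_lift_def)
  moreover have "\<forall>z\<in>A. f (k1 (b, z)) = h (b, z)" using k1 abc by (auto simp: cylinder_lift_def)
  ultimately obtain k2 where "cylinder_lift X Z f h b c A (\<lambda>z. k1 (b, z)) k2"
    using N2 A unfolding lifts_over_retracts_def by blast
  from cylinder_lift_glue[OF k1 this abc]
  show "\<exists>k. cylinder_lift X Z f h a c A g k" by blast
qed

text \<open>The lifting property is available only for homotopies that start at time \<open>0\<close> and run through all
of \<open>[0,1]\<close>. The homotopy on \<open>[a,b]\<close> is therefore shifted to start at \<open>0\<close> and, once it has reached time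
\<open>b\<close>, held constant; this keeps it inside \<open>V\<close>.\<close>

lemma lifts_over_retracts_in_piece:
  assumes HV: "homotopy_lifting_property Z (subtopology X (map_preimage X f V)) (subtopology Y V) f"
    and h: "continuous_map (prod_topology (top_of_set {0..1::real}) Z) Y h"
    and ab: "0 \<le> a" "a \<le> b" "b \<le> 1"
    and hN: "\<And>t z. t \<in> {a..b} \<Longrightarrow> z \<in> N \<Longrightarrow> h (t, z) \<in> V"
  shows "lifts_over_retracts X Z f h a b N"
  unfolding lifts_over_retracts_def
proof (intro allI impI; elim conjE)
  let ?I = "top_of_set {0..1::real}"
  fix A g
  assume A: "A retract_of_space Z" "A \<subseteq> N"
    and g: "continuous_map (subtopology Z A) X g" "\<forall>z\<in>A. f (g z) = h (a, z)"
  let ?A = "subtopology Z A"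
  let ?E = "subtopology X (map_preimage X f V)"
  have AZ: "A \<subseteq> topspace Z" using A(1) by (rule retract_of_space_imp_subset)
  then have tA: "topspace ?A = A" by (rule topspace_subtopology_subset)
  obtain r where "retraction_maps Z ?A r id"
    using A(1) by (auto simp: retract_of_space_retraction_maps)
  then have HA: "homotopy_lifting_property ?A ?E (subtopology Y V) f"
    by (rule homotopy_lifting_property_retract[OF HV])
  let ?h = "\<lambda>w. h (min (a + fst w) b, snd w)"
  have fst: "continuous_map (prod_topology (top_of_set J) ?A) euclideanreal fst" for J
    using continuous_map_fst[of "top_of_set J" ?A] by (simp add: continuous_map_in_subtopology)
  have "continuous_map (prod_topology ?I ?A) Y ?h"
  proof (rule continuous_map_compose_paired[OF h])
    show "continuous_map (prod_topology ?I ?A) ?I (\<lambda>w. min (a + fst w) b)"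
      using ab by (auto simp: continuous_map_in_subtopology min_le_iff_disj intro!: continuous_intros fst)
    show "continuous_map (prod_topology ?I ?A) Z snd"
      using continuous_map_snd[of ?I ?A] by (simp add: continuous_map_in_subtopology)
  qed
  moreover have "?h w \<in> V" if "w \<in> topspace (prod_topology ?I ?A)" for w
    using that ab A(2) by (intro hN) auto
  ultimately have h': "continuous_map (prod_topology ?I ?A) (subtopology Y V) ?h"
    by (auto simp: continuous_map_in_subtopology)
  have "g z \<in> map_preimage X f V" if "z \<in> A" for z
    using that g(2) hN[of a z] ab A(2) tA continuous_map_image_subset_topspace[OF g(1)] by auto
  then have g': "continuous_map ?A ?E g"
    using g(1) tA by (auto simp: continuous_map_in_subtopology)
  have "f (g z) = ?h (0, z)" if "z \<in> topspace ?A" for z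
    using that g(2) ab tA by (auto simp: min_def)
  with HA[unfolded homotopy_lifting_property_def, rule_format, of ?h g] h' g' tA
  obtain k where k: "continuous_map (prod_topology ?I ?A) ?E k"
      "\<forall>z\<in>A. k (0, z) = g z" "\<forall>t\<in>{0..1}. \<forall>z\<in>A. f (k (t, z)) = ?h (t, z)"
    by auto
  have "continuous_map (prod_topology (top_of_set {a..b}) ?A) X (\<lambda>w. k (fst w - a, snd w))"
  proof (rule continuous_map_compose_paired[OF _ _ continuous_map_snd])
    show "continuous_map (prod_topology ?I ?A) X k"
      using k(1) by (simp add: continuous_map_in_subtopology)
    show "continuous_map (prod_topology (top_of_set {a..b}) ?A) ?I (\<lambda>w. fst w - a)"
      using ab by (auto simp: continuous_map_in_subtopology intro!: continuous_intros fst)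
  qed
  then have "cylinder_lift X Z f h a b A g (\<lambda>w. k (fst w - a, snd w))"
    using k(2,3) ab by (auto simp: cylinder_lift_def)
  then show "\<exists>k. cylinder_lift X Z f h a b A g k" by blast
qed

text \<open>Every point \<open>(x, z0)\<close> has a product neighbourhood that is mapped into one of the sets \<open>V\<close>, so that short
time intervals around \<open>x\<close> are unproblematic. Bolzano induction replaces the explicit choice
of a subdivision of \<open>[0,1]\<close>.\<close>

lemma lifts_over_retracts_near_point:
  assumes loc: "\<And>y. y \<in> topspace Y \<Longrightarrow> \<exists>V. openin Y V \<and> y \<in> V \<and>
        homotopy_lifting_property Z (subtopology X (map_preimage X f V)) (subtopology Y V) f"
    and h: "continuous_map (prod_topology (top_of_set {0..1::real}) Z) Y h"
    and z0: "z0 \<in> topspace Z"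
  shows "\<exists>N. openin Z N \<and> z0 \<in> N \<and> lifts_over_retracts X Z f h 0 1 N"
proof -
  let ?I = "top_of_set {0..1::real}"
  have "(0::real) \<le> 1" by simp
  then have "0 \<le> (0::real) \<and> 1 \<le> (1::real) \<longrightarrow> (\<exists>N. openin Z N \<and> z0 \<in> N \<and> lifts_over_retracts X Z f h 0 1 N)"
  proof (induction rule: Bolzano[where P =
        "\<lambda>a b. 0 \<le> a \<and> b \<le> 1 \<longrightarrow> (\<exists>N. openin Z N \<and> z0 \<in> N \<and> lifts_over_retracts X Z f h a b N)"])
    case (trans a b c)
    show ?case
    proof (intro impI, elim conjE)
      assume ac: "0 \<le> a" "c \<le> 1"
      then obtain N1 N2 where N: "openin Z N1" "z0 \<in> N1" "lifts_over_retracts X Z f h a b N1"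
          "openin Z N2" "z0 \<in> N2" "lifts_over_retracts X Z f h b c N2"
        using trans by auto
      then show "\<exists>N. openin Z N \<and> z0 \<in> N \<and> lifts_over_retracts X Z f h a c N"
        using lifts_over_retracts_trans[OF N(3,6) trans(3,4)] by (intro exI[of _ "N1 \<inter> N2"]) auto
    qed
  next
    case (local x)
    then have "(x, z0) \<in> topspace (prod_topology ?I Z)" using z0 by simp
    then have "h (x, z0) \<in> topspace Y"
      using continuous_map_image_subset_topspace[OF h] by blast
    then obtain V where V: "openin Y V" "h (x, z0) \<in> V"
        and HV: "homotopy_lifting_property Z (subtopology X (map_preimage X f V)) (subtopology Y V) f"
      using loc by blast
    have "openin (prod_topology ?I Z) {w \<in> topspace (prod_topology ?I Z). h w \<in> V}"
      by (rule openin_continuous_map_preimage[OF h V(1)])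
    moreover have "(x, z0) \<in> {w \<in> topspace (prod_topology ?I Z). h w \<in> V}"
      using local z0 V(2) by simp
    ultimately obtain J N where J: "openin ?I J" "x \<in> J" and N: "openin Z N" "z0 \<in> N"
        and JN: "J \<times> N \<subseteq> {w \<in> topspace (prod_topology ?I Z). h w \<in> V}"
      unfolding openin_prod_topology_alt by meson
    obtain d where d: "d > 0" "\<And>s. s \<in> {0..1} \<Longrightarrow> \<bar>s - x\<bar> < d \<Longrightarrow> s \<in> J"
      using openin_unit_interval_ball[OF J] by blast
    have "lifts_over_retracts X Z f h a b N" if ab: "a \<le> x" "x \<le> b" "b - a < d" "0 \<le> a" "b \<le> 1" for a b
    proof (rule lifts_over_retracts_in_piece[OF HV h])
      show "h (t, z) \<in> V" if "t \<in> {a..b}" "z \<in> N" for t z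
      proof -
        have "t \<in> J" using that ab by (intro d(2)) auto
        then show ?thesis using JN that by auto
      qed
    qed (use ab in auto)
    with d(1) N show ?case by blast
  qed
  then show ?thesis by simp
qed

section \<open>Gluing local lifts\<close>

text \<open>The open sets \<open>[0,1] \<times> W\<close> over which lifts exist cover \<open>[0,1] \<times> Z\<close>. Two such lifts restrict
on \<open>[0,1] \<times> {z}\<close> to path lifts of the same path with the same initial point \<open>g z\<close>, so they agree on
overlaps.\<close>

lemma homotopy_lifting_property_local:
  assumes upl: "unique_path_lifting X f"
    and base: "neighbourhood_base_of (\<lambda>A. A retract_of_space Z) Z"
    and loc: "\<And>y. y \<in> topspace Y \<Longrightarrow> \<exists>V. openin Y V \<and> y \<in> V \<and>
        homotopy_lifting_property Z (subtopology X (map_preimage X f V)) (subtopology Y V) f"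
  shows "homotopy_lifting_property Z X Y f"
  unfolding homotopy_lifting_property_def
proof (intro allI impI, elim conjE)
  let ?I = "top_of_set {0..1::real}"
  fix h g
  assume h: "continuous_map (prod_topology ?I Z) Y h" and g: "continuous_map Z X g"
    and hg: "\<forall>z\<in>topspace Z. f (g z) = h (0, z)"
  \<comment> \<open>Local lifts, indexed by the open set over which they are defined.\<close>
  define S where "S = {(W, k). openin Z W \<and> cylinder_lift X Z f h 0 1 W g k}"
  have cover: "\<exists>W k. (W, k) \<in> S \<and> z0 \<in> W" if z0: "z0 \<in> topspace Z" for z0
  proof -
    obtain N where N: "openin Z N" "z0 \<in> N" "lifts_over_retracts X Z f h 0 1 N"
      using lifts_over_retracts_near_point[OF loc h z0] by blast
    obtain W A where WA: "openin Z W" "A retract_of_space Z" "z0 \<in> W" "W \<subseteq> A" "A \<subseteq> N"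
      using base N unfolding neighbourhood_base_of by meson
    have "A \<subseteq> topspace Z" using WA(2) by (rule retract_of_space_imp_subset)
    then obtain k where "cylinder_lift X Z f h 0 1 A g k"
      using N(3) WA(2,5) g hg continuous_map_from_subtopology unfolding lifts_over_retracts_def by blast
    then have "cylinder_lift X Z f h 0 1 W g k"
      using WA(4) by (rule cylinder_lift_subset)
    then have "(W, k) \<in> S" using WA by (auto simp: S_def)
    then show ?thesis using WA(3) by blast
  qed
  have unique: "k (t, z) = k' (t, z)"
    if S: "(W, k) \<in> S" "(W', k') \<in> S" and z: "z \<in> W" "z \<in> W'" and t: "t \<in> {0..1}" for W k W' k' t z
  proof -
    have path: "pathin X (\<lambda>s. l (s, z))" if "(M, l) \<in> S" "z \<in> M" for M l
    proof -
      have "z \<in> topspace (subtopology Z M)" using that openin_subset by (auto simp: S_def)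
      then show ?thesis
        unfolding pathin_def using that(1)
        by (intro continuous_map_compose_paired[of ?I "subtopology Z M" X l]) (auto simp: S_def cylinder_lift_def)
    qed
    have "\<forall>t\<in>{0..1}. f (k (t, z)) = f (k' (t, z))" "k (0, z) = k' (0, z)"
      using S z by (auto simp: S_def cylinder_lift_def)
    with upl[unfolded unique_path_lifting_def] path[OF S(1) z(1)] path[OF S(2) z(2)] t
    show ?thesis by blast
  qed
  obtain k where k: "continuous_map (prod_topology ?I Z) X k"
      "\<And>w i. \<lbrakk>i \<in> S; w \<in> topspace (prod_topology ?I Z) \<inter> ({0..1} \<times> fst i)\<rbrakk> \<Longrightarrow> k w = snd i w"
  proof (rule pasting_lemma_exists[where X = "prod_topology ?I Z" and I = S
        and T = "\<lambda>i. {0..1} \<times> fst i" and Y = X and f = snd])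
    show "topspace (prod_topology ?I Z) \<subseteq> (\<Union>i\<in>S. {0..1} \<times> fst i)"
      using cover by fastforce
    show "openin (prod_topology ?I Z) ({0..1} \<times> fst i)" if "i \<in> S" for i
      using that by (auto simp: S_def openin_prod_Times_iff)
    show "continuous_map (subtopology (prod_topology ?I Z) ({0..1} \<times> fst i)) X (snd i)" if "i \<in> S" for i
      using that by (auto simp: S_def cylinder_lift_def subtopology_Times subtopology_subtopology)
    show "snd i w = snd j w"
      if "i \<in> S" "j \<in> S" "w \<in> topspace (prod_topology ?I Z) \<inter> ({0..1} \<times> fst i) \<inter> ({0..1} \<times> fst j)" for i j w
      using that unique[of "fst i" "snd i" "fst j" "snd j" "snd w" "fst w"] by auto
  qed blast
  have val: "k (0, z) = g z \<and> f (k (t, z)) = h (t, z)" if z: "z \<in> topspace Z" and t: "t \<in> {0..1}" for t z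
  proof -
    obtain W l where W: "(W, l) \<in> S" "z \<in> W" using cover[OF z] by blast
    then show ?thesis using k(2)[OF W(1), of "(0,z)"] k(2)[OF W(1), of "(t,z)"] z t by (auto simp: S_def cylinder_lift_def)
  qed
  show "\<exists>k. continuous_map (prod_topology ?I Z) X k \<and> (\<forall>z\<in>topspace Z. k (0, z) = g z) \<and>
           (\<forall>t\<in>{0..1}. \<forall>z\<in>topspace Z. f (k (t, z)) = h (t, z))"
    using k(1) val by (intro exI[of _ k]) fastforce
qed

section \<open>Small retracts of cubes\<close>

text \<open>Retract each factor separately. Finiteness of \<open>I\<close> is what makes a product of open sets open.\<close>

lemma neighbourhood_base_of_retracts_product:
  assumes fin: "finite I"
    and nb: "\<And>i. i \<in> I \<Longrightarrow> neighbourhood_base_of (\<lambda>A. A retract_of_space (T i)) (T i)"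
  shows "neighbourhood_base_of (\<lambda>A. A retract_of_space (product_topology T I)) (product_topology T I)"
  unfolding neighbourhood_base_of
proof (intro allI impI, elim conjE)
  fix W x assume "openin (product_topology T I) W" and "x \<in> W"
  then obtain U where U: "\<forall>i\<in>I. openin (T i) (U i)" "x \<in> Pi\<^sub>E I U" "Pi\<^sub>E I U \<subseteq> W"
    unfolding openin_product_topology_alt by meson
  have "\<forall>i\<in>I. \<exists>O' A. openin (T i) O' \<and> A retract_of_space (T i) \<and> x i \<in> O' \<and> O' \<subseteq> A \<and> A \<subseteq> U i"
    using nb U unfolding neighbourhood_base_of by (meson PiE_mem)
  then obtain G A where GA: "\<And>i. i \<in> I \<Longrightarrow> openin (T i) (G i) \<and> A i retract_of_space (T i) \<and> x i \<in> G i \<and> G i \<subseteq> A i \<and> A i \<subseteq> U i"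
    by metis
  then obtain r where r: "\<And>i. i \<in> I \<Longrightarrow> continuous_map (T i) (subtopology (T i) (A i)) (r i) \<and> (\<forall>a\<in>A i. r i a = a)"
    unfolding retract_of_space_def by metis
  have sub: "A i \<subseteq> topspace (T i)" if "i \<in> I" for i
    using GA[OF that] retract_of_space_imp_subset by blast
  have "Pi\<^sub>E I A retract_of_space (product_topology T I)"
    unfolding retract_of_space_def
  proof (intro conjI exI[of _ "\<lambda>y. \<lambda>i\<in>I. r i (y i)"] ballI)
    show "Pi\<^sub>E I A \<subseteq> topspace (product_topology T I)"
      using sub by (auto simp: PiE_iff)
    have "continuous_map (product_topology T I) (subtopology (T i) (A i)) (\<lambda>y. r i (y i))" if "i \<in> I" for i
      using continuous_map_compose[OF continuous_map_product_projection[OF that]] r[OF that]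
      unfolding o_def by blast
    then show "continuous_map (product_topology T I) (subtopology (product_topology T I) (Pi\<^sub>E I A))
                 (\<lambda>y. \<lambda>i\<in>I. r i (y i))"
      unfolding subtopology_product_topology
      by (auto simp: continuous_map_componentwise)
    show "(\<lambda>i\<in>I. r i (y i)) = y" if "y \<in> Pi\<^sub>E I A" for y
      using that r by (auto simp: PiE_iff extensional_def fun_eq_iff)
  qed
  moreover have "openin (product_topology T I) (Pi\<^sub>E I G)"
    using GA fin by (simp add: openin_PiE)
  moreover have "x \<in> Pi\<^sub>E I G" using GA U(2) by (simp add: PiE_iff)
  moreover have "Pi\<^sub>E I G \<subseteq> Pi\<^sub>E I A" using GA by (intro PiE_mono) simp
  moreover have "Pi\<^sub>E I A \<subseteq> Pi\<^sub>E I U" using GA by (intro PiE_mono) simp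
  then have "Pi\<^sub>E I A \<subseteq> W" using U(3) by (rule order_trans)
  ultimately show "\<exists>U V. openin (product_topology T I) U \<and> V retract_of_space product_topology T I \<and>
      x \<in> U \<and> U \<subseteq> V \<and> V \<subseteq> W"
    by (intro exI[of _ "Pi\<^sub>E I G"] exI[of _ "Pi\<^sub>E I A"] conjI)
qed

lemma neighbourhood_base_of_retracts_interval:
  "neighbourhood_base_of (\<lambda>A. A retract_of_space (top_of_set {0..1::real})) (top_of_set {0..1})"
  unfolding neighbourhood_base_of
proof (intro allI impI, elim conjE)
  let ?I = "top_of_set {0..1::real}"
  fix W x assume W: "openin ?I W" "x \<in> W"
  obtain e where e: "e > 0" "\<And>y. y \<in> {0..1} \<Longrightarrow> \<bar>y - x\<bar> < e \<Longrightarrow> y \<in> W"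
    by (rule openin_unit_interval_ball[OF W]) (rule that)
  have x: "x \<in> {0..1}" using openin_subset[OF W(1)] W(2) by auto
  define a b where "a = max 0 (x - e/2)" and "b = min 1 (x + e/2)"
  have ab: "0 \<le> a" "a \<le> b" "b \<le> 1" using x e by (auto simp: a_def b_def)
  have "{a..b} retract_of_space ?I"
    unfolding retract_of_space_def
    using ab by (intro conjI exI[of _ "\<lambda>y. max a (min b y)"])
                (auto simp: continuous_map_in_subtopology intro!: continuous_intros)
  moreover have "openin ?I ({0..1} \<inter> ball x (e/2))" by (auto simp: openin_open)
  moreover have "{0..1} \<inter> ball x (e/2) \<subseteq> {a..b}"
    by (auto simp: a_def b_def dist_real_def abs_if split: if_splits)
  moreover have "{a..b} \<subseteq> W" using e by (auto simp: a_def b_def dist_real_def)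
  ultimately show "\<exists>U V. openin ?I U \<and> V retract_of_space ?I \<and> x \<in> U \<and> U \<subseteq> V \<and> V \<subseteq> W"
    using x e(1) by (intro exI[of _ "{0..1} \<inter> ball x (e/2)"] exI[of _ "{a..b}"]) auto
qed

lemma neighbourhood_base_of_retracts_cube:
  "neighbourhood_base_of (\<lambda>A. A retract_of_space (cube n)) (cube n)"
  unfolding cube_def
  by (intro neighbourhood_base_of_retracts_product neighbourhood_base_of_retracts_interval) auto

section \<open>Local Peano covering maps\<close>

text \<open>A point \<open>y\<close> of a path component \<open>C\<close> of \<open>f\<^sup>-\<^sup>1(U)\<close> has an open neighbourhood in \<open>C\<close>: its own component in
\<open>f\<^sup>-\<^sup>1(U \<inter> V)\<close>, where \<open>V\<close> is one of the given sets that contains \<open>f y\<close>.\<close>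

lemma peano_map_local:
  assumes cont: "continuous_map X Y f"
    and loc: "\<And>y. y \<in> topspace Y \<Longrightarrow> \<exists>V. openin Y V \<and> y \<in> V \<and>
        peano_map (subtopology X (map_preimage X f V)) (subtopology Y V) f"
  shows "peano_map X Y f"
  unfolding peano_map_iff
proof (intro conjI cont allI impI; elim conjE)
  fix U x assume U: "openin Y U" and x: "x \<in> map_preimage X f U"
  let ?C = "path_component_of_set (subtopology X (map_preimage X f U))"
  have "\<exists>G. openin X G \<and> y \<in> G \<and> G \<subseteq> ?C x" if y: "y \<in> ?C x" for y
  proof -
    have yU: "y \<in> topspace X" "f y \<in> U"
      using y path_component_of_subset_topspace[of "subtopology X (map_preimage X f U)" x] by auto
    then obtain V where V: "openin Y V" "f y \<in> V"
        "peano_map (subtopology X (map_preimage X f V)) (subtopology Y V) f"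
      using loc[of "f y"] openin_subset[OF U] by blast
    let ?E = "subtopology X (map_preimage X f V)"
    let ?G = "path_component_of_set (subtopology X (map_preimage X f (U \<inter> V))) y"
    have "openin (subtopology Y V) (U \<inter> V)" using U V by (simp add: openin_open_subtopology openin_Int)
    then have "openin ?E ?G"
      using peano_map_openin_component[OF V(3), of "U \<inter> V" y] V(2) yU
        map_preimage_subtopology[of "U \<inter> V" V X f] by simp
    then have "openin X ?G" using openin_continuous_map_preimage[OF cont V(1)] by (rule openin_trans_full)
    moreover have "y \<in> ?G" using yU V(2) by (auto simp: path_component_of_refl)
    moreover have "?G \<subseteq> ?C y"
      using path_component_of_mono[of X "map_preimage X f (U \<inter> V)" y _ "map_preimage X f U"] by fastforce
    moreover have "?C y \<subseteq> ?C x" using y path_component_of_trans by fastforce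
    ultimately show ?thesis by blast
  qed
  then show "openin X (?C x)" by (intro iffD2[OF openin_subopen] ballI)
next
  fix G x assume G: "openin X G" "x \<in> G"
  then have "x \<in> topspace X" using openin_subset by blast
  then have "f x \<in> topspace Y" using cont continuous_map_image_subset_topspace by blast
  then obtain V where V: "openin Y V" "f x \<in> V"
      "peano_map (subtopology X (map_preimage X f V)) (subtopology Y V) f"
    using loc by blast
  let ?E = "subtopology X (map_preimage X f V)"
  have "openin ?E (G \<inter> map_preimage X f V)" "x \<in> G \<inter> map_preimage X f V"
    using G V(2) \<open>x \<in> topspace X\<close> by (auto simp: openin_subtopology)
  then obtain W where W: "openin (subtopology Y V) W" "f x \<in> W"
      "path_component_of_set (subtopology ?E (map_preimage ?E f W)) x \<subseteq> G \<inter> map_preimage X f V"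
    using peano_map_small_component[OF V(3)] by blast
  then have "openin Y W" "W \<subseteq> V" using V(1) by (auto simp: openin_open_subtopology)
  with W map_preimage_subtopology[of W V X f]
  show "\<exists>U. openin Y U \<and> f x \<in> U \<and> path_component_of_set (subtopology X (map_preimage X f U)) x \<subseteq> G"
    by auto
qed

lemma peano_covering_map_local:
  assumes cont: "continuous_map X Y f"
    and loc: "\<And>y. y \<in> topspace Y \<Longrightarrow> \<exists>V. openin Y V \<and> y \<in> V \<and>
        peano_covering_map (subtopology X (map_preimage X f V)) (subtopology Y V) f"
  shows "peano_covering_map X Y f"
  unfolding peano_covering_map_def serre_fibration_def
proof (intro conjI cont allI ballI)
  show "peano_map X Y f"
    using loc by (intro peano_map_local[OF cont]) (meson peano_covering_map_def)
  show "homotopy_lifting_property (cube n) X Y f" for n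
    using loc
    by (intro homotopy_lifting_property_local[OF unique_path_lifting_local[OF cont]
          neighbourhood_base_of_retracts_cube])
       (meson peano_covering_map_def serre_fibration_def)+
next
  fix y C assume y: "y \<in> topspace Y" and C: "C \<in> path_components_of (subtopology X (map_preimage X f {y}))"
  then obtain V where V: "y \<in> V"
      "peano_covering_map (subtopology X (map_preimage X f V)) (subtopology Y V) f"
    using loc by blast
  have "C \<in> path_components_of (subtopology (subtopology X (map_preimage X f V))
      (map_preimage (subtopology X (map_preimage X f V)) f {y}))"
    using C V(1) map_preimage_subtopology[of "{y}" V X f] by simp
  with V y show "\<exists>x. C = {x}" unfolding peano_covering_map_def by auto
qed

theorem proposition6p7:
  fixes X :: "'a topology" and Y :: "'b topology" and f :: "'a \<Rightarrow> 'b"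
  assumes "continuous_map X Y f"
  shows "(peano_covering_map X Y f \<longrightarrow>
            (\<forall>U. openin Y U \<longrightarrow>
               peano_covering_map (subtopology X (map_preimage X f U)) (subtopology Y U) f))
       \<and> ((\<forall>y \<in> topspace Y. \<exists>U. neighbourhood_in Y y U \<and>
               peano_covering_map (subtopology X (map_preimage X f U)) (subtopology Y U) f) \<longrightarrow>
            peano_covering_map X Y f)"
proof (intro conjI impI allI)
  fix U assume "peano_covering_map X Y f" "openin Y U"
  then show "peano_covering_map (subtopology X (map_preimage X f U)) (subtopology Y U) f"
    by (rule peano_covering_map_restrict_open)
next
  assume nbhd: "\<forall>y \<in> topspace Y. \<exists>U. neighbourhood_in Y y U \<and>
               peano_covering_map (subtopology X (map_preimage X f U)) (subtopology Y U) f"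
  show "peano_covering_map X Y f"
  proof (rule peano_covering_map_local[OF assms])
    fix y assume "y \<in> topspace Y"
    then obtain U V where UV: "openin Y V" "y \<in> V" "V \<subseteq> U"
        and P: "peano_covering_map (subtopology X (map_preimage X f U)) (subtopology Y U) f"
      using nbhd unfolding neighbourhood_in_def by meson
    have "openin (subtopology Y U) V" using UV by (auto simp: openin_subtopology)
    from peano_covering_map_restrict_open[OF P this]
    have "peano_covering_map (subtopology X (map_preimage X f V)) (subtopology Y V) f"
      unfolding map_preimage_subtopology[OF UV(3)]
      using UV(3) by (simp add: subtopology_subtopology Int_absorb1)
    with UV show "\<exists>V. openin Y V \<and> y \<in> V \<and>
        peano_covering_map (subtopology X (map_preimage X f V)) (subtopology Y V) f" by blast
  qed
qed

end
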